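(* Let $\mathcal R$ be a protorootoid. Then $\mathcal R$ is preprincipal if and only if its abridgement $\mathcal R^{a}$ is principal. In that case, the set of atomic morphisms of $\mathcal R$ coincides with the set of simple morphisms of $\mathcal R^{a}$.
   Context: A groupoid is a small category in which every morphism is invertible. For a groupoid $G$ and $a,b\in\mathrm{ob}(G)$, ${}_aG_b=\mathrm{Hom}_G(b,a)$, ${}_aG$ is the set of morphisms with codomain $a$, and $g^*=g^{-1}$. A Boolean ring is a (possibly non-unital) ring in which every element is idempotent, partially ordered by $x\subseteq y\iff xy=x$; write $x\cap y=xy$ and $\emptyset=0$. Ring homomorphisms are not required to preserve identities; $\mathbf{BRng}$ is the resulting category. A protorootoid is a triple $\mathcal R=(G,\Lambda,N)$ with $G$ a groupoid, $\Lambda\colon G\to\mathbf{BRng}$ a functor, and $N$ a function assigning to each $g\in{}_aG$ an element $N(g)\in\Lambda(a)$ such that $N(gh)=N(g)+gN(h)$ whenever $gh$ is defined, where $gx:=\Lambda(g)(x)$. The weak order at $a$ is the subposet ${}_a\mathcal L:=\{N(g)\mid g\in{}_aG\}$ of $\Lambda(a)$; its minimum is $\emptyset$. The abridgement of $\mathcal R$ is $\mathcal R^{a}=(G,\Lambda',N')$, where $\Lambda'(a)$ is the subring of $\Lambda(a)$ generated by ${}_a\mathcal L$, $\Lambda'(g)$ is the restriction of $\Lambda(g)$, and $N'$ is $N$ regarded as taking values in the $\Lambda'(a)$. $\mathcal R$ is faithful if for $g\in{}_aG$, $N(g)=\emptyset$ implies $g=1_a$. $\mathcal R$ is interval finite if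 for all $a$ and $g\in{}_aG$ the set $\{A\in{}_a\mathcal L\mid A\subseteq N(g)\}$ is finite. An element $x$ of a Boolean ring $B$ has finite rank if $xB=\{y\in B\mid y\subseteq x\}$ is finite, and then $\mathrm{rank}(x)$ is the number of atoms of $B$ contained in $xB$. $\mathcal R$ is cocycle finite if all $N(g)$ have finite rank, and then $l_N(g):=\mathrm{rank}(N(g))$. A morphism $s\in{}_aG$ is atomic (for $\mathcal R$) if $N(s)$ is an atom of the poset ${}_a\mathcal L$, and simple if $N(s)$ is an atom of the Boolean ring $\Lambda(a)$; the sets of these are denoted $A_{\mathcal R}$ and $S_{\mathcal R}$. A set $S\subseteq\mathrm{mor}(G)$ generates $G$ if every non-identity morphism is a product of elements of $S\cup S^*$; then $l_S(g)$ is the minimal number of factors in such a product with value $g$ ($l_S=0$ on identity morphisms). $\mathcal R$ is principal if it is cocycle finite, $S:=S_{\mathcal R}$ generates $G$, and $l_S=l_N$. $\mathcal R$ is preprincipal if it is faithful and interval finite, and for all $a\in\mathrm{ob}(G)$, $g\in{}_aG$ and $s\in A_{\mathcal R}\cap{}_aG$, either $N(g)\cap N(s)=\emptyset$ or $N(s)\subseteq N(g)$. *)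

theory Defs
  imports "HOL-Algebra.AbelCoset"
begin

section \<open>Groupoids\<close>

text \<open>\<^term>\<open>gcomp G g h\<close> is "first \<open>h\<close>, then \<open>g\<close>"; it is meaningful only if
  \<^prop>\<open>source G g = target G h\<close>.\<close>

record ('o, 'm) groupoid =
  ob :: "'o set"
  mor :: "'m set"
  source :: "'m \<Rightarrow> 'o"
  target :: "'m \<Rightarrow> 'o"
  ident :: "'o \<Rightarrow> 'm"
  gcomp :: "'m \<Rightarrow> 'm \<Rightarrow> 'm"

locale groupoid =
  fixes G :: "('o, 'm) groupoid"
  assumes source_closed: "g \<in> mor G \<Longrightarrow> source G g \<in> ob G"
    and target_closed: "g \<in> mor G \<Longrightarrow> target G g \<in> ob G"
    and ident_closed: "a \<in> ob G \<Longrightarrow> ident G a \<in> mor G"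
    and source_ident: "a \<in> ob G \<Longrightarrow> source G (ident G a) = a"
    and target_ident: "a \<in> ob G \<Longrightarrow> target G (ident G a) = a"
    and comp_closed: "\<lbrakk>g \<in> mor G; h \<in> mor G; source G g = target G h\<rbrakk>
          \<Longrightarrow> gcomp G g h \<in> mor G"
    and source_comp: "\<lbrakk>g \<in> mor G; h \<in> mor G; source G g = target G h\<rbrakk>
          \<Longrightarrow> source G (gcomp G g h) = source G h"
    and target_comp: "\<lbrakk>g \<in> mor G; h \<in> mor G; source G g = target G h\<rbrakk>
          \<Longrightarrow> target G (gcomp G g h) = target G g"
    and comp_assoc: "\<lbrakk>g \<in> mor G; h \<in> mor G; k \<in> mor G;
            source G g = target G h; source G h = target G k\<rbrakk>
          \<Longrightarrow> gcomp G (gcomp G g h) k = gcomp G g (gcomp G h k)"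
    and comp_ident_left: "g \<in> mor G \<Longrightarrow> gcomp G (ident G (target G g)) g = g"
    and comp_ident_right: "g \<in> mor G \<Longrightarrow> gcomp G g (ident G (source G g)) = g"
    and inverse_ex: "g \<in> mor G \<Longrightarrow>
          \<exists>h\<in>mor G. source G h = target G g \<and> target G h = source G g \<and>
            gcomp G h g = ident G (source G g) \<and> gcomp G g h = ident G (target G g)"

definition morphisms_to :: "('o, 'm) groupoid \<Rightarrow> 'o \<Rightarrow> 'm set" where
  "morphisms_to G a = {g \<in> mor G. target G g = a}"

definition ginv :: "('o, 'm) groupoid \<Rightarrow> 'm \<Rightarrow> 'm" where
  "ginv G g = (THE h. h \<in> mor G \<and> source G h = target G g \<and> target G h = source G g \<and>
     gcomp G h g = ident G (source G g) \<and> gcomp G g h = ident G (target G g))"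

text \<open>Products of nonempty composable lists \<open>[g\<^sub>1, \<dots>, g\<^sub>n]\<close>, in the order \<open>g\<^sub>1 \<cdots> g\<^sub>n\<close>;
  the value on the empty list is irrelevant.\<close>

fun comp_list :: "('o, 'm) groupoid \<Rightarrow> 'm list \<Rightarrow> 'm" where
  "comp_list G [] = undefined"
| "comp_list G [g] = g"
| "comp_list G (g # h # hs) = gcomp G g (comp_list G (h # hs))"

definition is_product :: "('o, 'm) groupoid \<Rightarrow> 'm set \<Rightarrow> 'm \<Rightarrow> 'm list \<Rightarrow> bool" where
  "is_product G T g gs \<longleftrightarrow> gs \<noteq> [] \<and> set gs \<subseteq> T \<and>
     successively (\<lambda>h k. source G h = target G k) gs \<and> comp_list G gs = g"

definition generates :: "('o, 'm) groupoid \<Rightarrow> 'm set \<Rightarrow> bool" where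
  "generates G S \<longleftrightarrow> S \<subseteq> mor G \<and>
     (\<forall>g\<in>mor G - ident G ` ob G. \<exists>gs. is_product G (S \<union> ginv G ` S) g gs)"

text \<open>Only meaningful if \<open>S\<close> generates \<open>G\<close>.\<close>

definition gen_length :: "('o, 'm) groupoid \<Rightarrow> 'm set \<Rightarrow> 'm \<Rightarrow> nat" where
  "gen_length G S g =
     (if g \<in> ident G ` ob G then 0
      else LEAST n. \<exists>gs. is_product G (S \<union> ginv G ` S) g gs \<and> length gs = n)"

section \<open>Boolean rings\<close>

text \<open>The library's \<open>ring\<close> record is used, but not its (unital) locale \<open>ring\<close>: Boolean rings
  need not have an identity, and the field \<open>one\<close> is never referred to.\<close>

locale boolean_ring = abelian_group B for B :: "'b ring" (structure) +
  assumes m_closed: "\<lbrakk>x \<in> carrier B; y \<in> carrier B\<rbrakk> \<Longrightarrow> x \<otimes> y \<in> carrier B"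
    and m_assoc: "\<lbrakk>x \<in> carrier B; y \<in> carrier B; z \<in> carrier B\<rbrakk>
          \<Longrightarrow> (x \<otimes> y) \<otimes> z = x \<otimes> (y \<otimes> z)"
    and l_distr: "\<lbrakk>x \<in> carrier B; y \<in> carrier B; z \<in> carrier B\<rbrakk>
          \<Longrightarrow> (x \<oplus> y) \<otimes> z = x \<otimes> z \<oplus> y \<otimes> z"
    and r_distr: "\<lbrakk>x \<in> carrier B; y \<in> carrier B; z \<in> carrier B\<rbrakk>
          \<Longrightarrow> z \<otimes> (x \<oplus> y) = z \<otimes> x \<oplus> z \<otimes> y"
    and idem: "x \<in> carrier B \<Longrightarrow> x \<otimes> x = x"

text \<open>Homomorphisms of possibly non-unital rings. As usual in HOL-Algebra, only the values on
  the carrier matter.\<close>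

definition brng_hom :: "'b ring \<Rightarrow> 'b ring \<Rightarrow> ('b \<Rightarrow> 'b) set" where
  "brng_hom B C = hom B C \<inter> hom (add_monoid B) (add_monoid C)"

definition brng_le :: "'b ring \<Rightarrow> 'b \<Rightarrow> 'b \<Rightarrow> bool" where
  "brng_le B x y \<longleftrightarrow> x \<otimes>\<^bsub>B\<^esub> y = x"

text \<open>Atoms of a subset \<open>P\<close> of \<open>B\<close>, regarded as a subposet; it is assumed that \<open>\<zero> \<in> P\<close>, so that
  \<open>\<zero>\<close> is the minimum of \<open>P\<close>. The atoms of \<open>B\<close> are those of \<open>carrier B\<close>.\<close>

definition is_atom :: "'b ring \<Rightarrow> 'b set \<Rightarrow> 'b \<Rightarrow> bool" where
  "is_atom B P x \<longleftrightarrow> x \<in> P \<and> x \<noteq> \<zero>\<^bsub>B\<^esub> \<and> (\<forall>y\<in>P. brng_le B y x \<longrightarrow> y = \<zero>\<^bsub>B\<^esub> \<or> y = x)"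

definition brng_down :: "'b ring \<Rightarrow> 'b \<Rightarrow> 'b set" where
  "brng_down B x = {y \<in> carrier B. brng_le B y x}"

definition finite_rank :: "'b ring \<Rightarrow> 'b \<Rightarrow> bool" where
  "finite_rank B x \<longleftrightarrow> finite (brng_down B x)"

text \<open>Only meaningful for elements of finite rank.\<close>

definition brng_rank :: "'b ring \<Rightarrow> 'b \<Rightarrow> nat" where
  "brng_rank B x = card {y \<in> brng_down B x. is_atom B (carrier B) y}"

definition nonunital_subring :: "'b set \<Rightarrow> 'b ring \<Rightarrow> bool" where
  "nonunital_subring H B \<longleftrightarrow> additive_subgroup H B \<and> (\<forall>x\<in>H. \<forall>y\<in>H. x \<otimes>\<^bsub>B\<^esub> y \<in> H)"

definition generated_subring :: "'b ring \<Rightarrow> 'b set \<Rightarrow> 'b set" where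
  "generated_subring B X = \<Inter>{H. nonunital_subring H B \<and> X \<subseteq> H}"

section \<open>Protorootoids\<close>

text \<open>\<open>bring R a\<close> is \<open>\<Lambda>(a)\<close> and \<open>act R g\<close> is \<open>\<Lambda>(g)\<close>. All carriers live in one
  ambient type; this is no restriction, since any family of rings can be transported into a
  common (disjoint sum) type.\<close>

record ('o, 'm, 'b) protorootoid =
  grpd :: "('o, 'm) groupoid"
  bring :: "'o \<Rightarrow> 'b ring"
  act :: "'m \<Rightarrow> 'b \<Rightarrow> 'b"
  cocycle :: "'m \<Rightarrow> 'b"

locale protorootoid =
  fixes R :: "('o, 'm, 'b) protorootoid"
  assumes grpd: "groupoid (grpd R)"
    and bring: "a \<in> ob (grpd R) \<Longrightarrow> boolean_ring (bring R a)"
    and act_hom: "g \<in> mor (grpd R) \<Longrightarrow>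
          act R g \<in> brng_hom (bring R (source (grpd R) g)) (bring R (target (grpd R) g))"
    and act_ident: "\<lbrakk>a \<in> ob (grpd R); x \<in> carrier (bring R a)\<rbrakk>
          \<Longrightarrow> act R (ident (grpd R) a) x = x"
    and act_comp: "\<lbrakk>g \<in> mor (grpd R); h \<in> mor (grpd R);
            source (grpd R) g = target (grpd R) h; x \<in> carrier (bring R (source (grpd R) h))\<rbrakk>
          \<Longrightarrow> act R (gcomp (grpd R) g h) x = act R g (act R h x)"
    and cocycle_closed: "g \<in> mor (grpd R) \<Longrightarrow>
          cocycle R g \<in> carrier (bring R (target (grpd R) g))"
    and cocycle_comp: "\<lbrakk>g \<in> mor (grpd R); h \<in> mor (grpd R);
            source (grpd R) g = target (grpd R) h\<rbrakk>
          \<Longrightarrow> cocycle R (gcomp (grpd R) g h) =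
              cocycle R g \<oplus>\<^bsub>bring R (target (grpd R) g)\<^esub> act R g (cocycle R h)"

definition weak_order :: "('o, 'm, 'b) protorootoid \<Rightarrow> 'o \<Rightarrow> 'b set" where
  "weak_order R a = cocycle R ` morphisms_to (grpd R) a"

definition abridgement :: "('o, 'm, 'b) protorootoid \<Rightarrow> ('o, 'm, 'b) protorootoid" where
  "abridgement R =
     (let L = \<lambda>a. generated_subring (bring R a) (weak_order R a)
      in \<lparr> grpd = grpd R,
           bring = (\<lambda>a. (bring R a)\<lparr>carrier := L a\<rparr>),
           act = (\<lambda>g. restrict (act R g) (L (source (grpd R) g))),
           cocycle = cocycle R \<rparr>)"

lemma additive_subgroup_Inter:
  assumes "abelian_group B" "\<F> \<noteq> {}" "\<And>H. H \<in> \<F> \<Longrightarrow> additive_subgroup H B"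
  shows "additive_subgroup (\<Inter>\<F>) B"
  using group.subgroups_Inter[OF abelian_group.a_group[OF assms(1)], of \<F>] assms
  by (auto simp: additive_subgroup_def)

context boolean_ring
begin

lemma nonunital_subring_carrier: "nonunital_subring (carrier B) B"
  unfolding nonunital_subring_def additive_subgroup_def
  using group.subgroup_self[OF a_group] m_closed by auto

lemma nonunital_subring_generated:
  assumes "X \<subseteq> carrier B"
  shows "nonunital_subring (generated_subring B X) B"
proof -
  have "additive_subgroup (\<Inter>{H. nonunital_subring H B \<and> X \<subseteq> H}) B"
    by (rule additive_subgroup_Inter[OF abelian_group_axioms])
      (use nonunital_subring_carrier assms in \<open>auto simp: nonunital_subring_def\<close>)
  then show ?thesis
    unfolding nonunital_subring_def generated_subring_def by blast
qed

lemma nonunital_subring_boolean_ring: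
  assumes H: "nonunital_subring H B"
  shows "boolean_ring (B\<lparr>carrier := H\<rparr>)"
proof -
  interpret H: additive_subgroup H B using H by (simp add: nonunital_subring_def)
  have sub: "x \<in> H \<Longrightarrow> x \<in> carrier B" for x by (rule H.a_Hcarr)
  have "abelian_group (B\<lparr>carrier := H\<rparr>)"
  proof (rule abelian_groupI)
    fix x assume "x \<in> carrier (B\<lparr>carrier := H\<rparr>)"
    then show "\<exists>y\<in>carrier (B\<lparr>carrier := H\<rparr>). y \<oplus>\<^bsub>B\<lparr>carrier := H\<rparr>\<^esub> x = \<zero>\<^bsub>B\<lparr>carrier := H\<rparr>\<^esub>"
      using H.a_inv_closed sub l_neg by (auto intro!: bexI[of _ "\<ominus> x"])
  qed (auto simp: sub a_assoc intro: a_comm)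
  then show ?thesis
    using H sub m_assoc l_distr r_distr idem
    by (auto simp: boolean_ring_def boolean_ring_axioms_def nonunital_subring_def)
qed

end

lemma generated_subring_incl: "X \<subseteq> generated_subring B X"
  by (auto simp: generated_subring_def)

lemma generated_subring_least:
  "\<lbrakk>nonunital_subring H B; X \<subseteq> H\<rbrakk> \<Longrightarrow> generated_subring B X \<subseteq> H"
  by (auto simp: generated_subring_def)

lemma nonunital_subring_vimage:
  assumes "boolean_ring B" "boolean_ring C" "f \<in> brng_hom B C" "nonunital_subring H C"
  shows "nonunital_subring {x \<in> carrier B. f x \<in> H} B"
proof -
  interpret B: boolean_ring B by fact
  interpret C: boolean_ring C by fact
  interpret H: additive_subgroup H C using assms(4) by (simp add: nonunital_subring_def)
  interpret f: group_hom "add_monoid B" "add_monoid C" f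
    using assms(3) B.a_group C.a_group
    by (simp add: group_hom_def group_hom_axioms_def brng_hom_def)
  have "subgroup {x \<in> carrier B. f x \<in> H} (add_monoid B)"
  proof (rule B.add.subgroupI)
    show "{x \<in> carrier B. f x \<in> H} \<noteq> {}"
      using f.hom_one by (auto intro!: exI[of _ "\<zero>\<^bsub>B\<^esub>"])
  next
    fix a assume a: "a \<in> {x \<in> carrier B. f x \<in> H}"
    then have "f (\<ominus>\<^bsub>B\<^esub> a) = \<ominus>\<^bsub>C\<^esub> f a" using f.hom_inv[of a] by (simp add: a_inv_def)
    then show "\<ominus>\<^bsub>B\<^esub> a \<in> {x \<in> carrier B. f x \<in> H}"
      using a H.a_inv_closed B.a_inv_closed by auto
  next
    fix a b assume "a \<in> {x \<in> carrier B. f x \<in> H}" "b \<in> {x \<in> carrier B. f x \<in> H}"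
    then show "a \<oplus>\<^bsub>B\<^esub> b \<in> {x \<in> carrier B. f x \<in> H}"
      using f.hom_mult[of a b] by auto
  qed auto
  then show ?thesis
    using assms(3,4) B.m_closed
    by (auto simp: nonunital_subring_def additive_subgroup_def brng_hom_def hom_def)
qed

lemma (in protorootoid) weak_order_subset_carrier: "weak_order R a \<subseteq> carrier (bring R a)"
  using cocycle_closed by (auto simp: weak_order_def morphisms_to_def)

lemma (in protorootoid) act_generated_subring:
  assumes g: "g \<in> mor (grpd R)"
    and x: "x \<in> generated_subring (bring R (source (grpd R) g)) (weak_order R (source (grpd R) g))"
  shows "act R g x \<in>
    generated_subring (bring R (target (grpd R) g)) (weak_order R (target (grpd R) g))"
proof -
  interpret G: groupoid "grpd R" by (rule grpd)
  define a b where "a = target (grpd R) g" and "b = source (grpd R) g"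
  have ob: "a \<in> ob (grpd R)" "b \<in> ob (grpd R)"
    using G.source_closed G.target_closed g by (auto simp: a_def b_def)
  interpret A: boolean_ring "bring R a" by (rule bring[OF ob(1)])
  interpret B: boolean_ring "bring R b" by (rule bring[OF ob(2)])
  let ?L = "generated_subring (bring R a) (weak_order R a)"
  have L: "nonunital_subring ?L (bring R a)"
    by (rule A.nonunital_subring_generated[OF weak_order_subset_carrier])
  interpret L: additive_subgroup ?L "bring R a" using L by (simp add: nonunital_subring_def)
  have hom: "act R g \<in> brng_hom (bring R b) (bring R a)"
    using act_hom[OF g] by (simp add: a_def b_def)
  have "generated_subring (bring R b) (weak_order R b) \<subseteq> {x \<in> carrier (bring R b). act R g x \<in> ?L}"
  proof (rule generated_subring_least)
    show "nonunital_subring {x \<in> carrier (bring R b). act R g x \<in> ?L} (bring R b)"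
      by (rule nonunital_subring_vimage[OF B.boolean_ring_axioms A.boolean_ring_axioms hom L])
    show "weak_order R b \<subseteq> {x \<in> carrier (bring R b). act R g x \<in> ?L}"
    proof
      fix y assume y: "y \<in> weak_order R b"
      then obtain h where h: "h \<in> mor (grpd R)" "target (grpd R) h = b" "y = cocycle R h"
        by (auto simp: weak_order_def morphisms_to_def)
      let ?gh = "gcomp (grpd R) g h"
      have gh: "?gh \<in> mor (grpd R)" "target (grpd R) ?gh = a"
        using G.comp_closed G.target_comp g h by (auto simp: a_def b_def)
      have mem: "cocycle R g \<in> ?L" "cocycle R ?gh \<in> ?L"
        using generated_subring_incl[of "weak_order R a" "bring R a"] g gh
        by (auto simp: weak_order_def morphisms_to_def a_def)
      have yc: "y \<in> carrier (bring R b)" using y weak_order_subset_carrier by blast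
      then have ac: "act R g y \<in> carrier (bring R a)"
        using hom by (auto simp: brng_hom_def hom_def)
      have "cocycle R ?gh = cocycle R g \<oplus>\<^bsub>bring R a\<^esub> act R g y"
        using cocycle_comp[OF g h(1)] h by (simp add: a_def b_def)
      then have "act R g y = \<ominus>\<^bsub>bring R a\<^esub> cocycle R g \<oplus>\<^bsub>bring R a\<^esub> cocycle R ?gh"
        using A.r_neg1[of "cocycle R g" "act R g y"] L.a_Hcarr[OF mem(1)] ac by simp
      then have "act R g y \<in> ?L"
        using L.a_inv_closed mem by simp
      then show "y \<in> {x \<in> carrier (bring R b). act R g x \<in> ?L}" using yc by simp
    qed
  qed
  then show ?thesis using x by (auto simp: a_def b_def)
qed

lemma (in protorootoid) protorootoid_abridgement: "protorootoid (abridgement R)"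
proof -
  interpret G: groupoid "grpd R" by (rule grpd)
  let ?L = "\<lambda>a. generated_subring (bring R a) (weak_order R a)"
  have L: "nonunital_subring (?L a) (bring R a)" if "a \<in> ob (grpd R)" for a
    by (rule boolean_ring.nonunital_subring_generated[OF bring[OF that] weak_order_subset_carrier])
  have Lc: "x \<in> carrier (bring R a)" if "a \<in> ob (grpd R)" "x \<in> ?L a" for a x
    using L[OF that(1)] that(2) additive_subgroup.a_Hcarr by (auto simp: nonunital_subring_def)
  have NL: "cocycle R g \<in> ?L (target (grpd R) g)" if "g \<in> mor (grpd R)" for g
    using generated_subring_incl[of "weak_order R (target (grpd R) g)"] that
    by (force simp: weak_order_def morphisms_to_def)
  have Lplus: "x \<oplus>\<^bsub>bring R a\<^esub> y \<in> ?L a" and Ltimes: "x \<otimes>\<^bsub>bring R a\<^esub> y \<in> ?L a"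
    if "a \<in> ob (grpd R)" "x \<in> ?L a" "y \<in> ?L a" for a x y
    using L[OF that(1)] that(2,3) additive_subgroup.a_closed
    by (auto simp: nonunital_subring_def)
  show ?thesis
  proof (rule protorootoid.intro)
    show "groupoid (grpd (abridgement R))" by (simp add: abridgement_def grpd)
  next
    fix a assume "a \<in> ob (grpd (abridgement R))"
    then show "boolean_ring (bring (abridgement R) a)"
      using boolean_ring.nonunital_subring_boolean_ring[OF bring L] by (simp add: abridgement_def)
  next
    fix g assume "g \<in> mor (grpd (abridgement R))"
    then have g: "g \<in> mor (grpd R)" by (simp add: abridgement_def)
    show "act (abridgement R) g \<in> brng_hom (bring (abridgement R) (source (grpd (abridgement R)) g))
            (bring (abridgement R) (target (grpd (abridgement R)) g))"
      using act_hom[OF g] act_generated_subring[OF g] Lc[OF G.source_closed[OF g]]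
        Lplus[OF G.source_closed[OF g]] Ltimes[OF G.source_closed[OF g]]
      by (auto simp: abridgement_def brng_hom_def hom_def)
  next
    fix a x assume "a \<in> ob (grpd (abridgement R))" "x \<in> carrier (bring (abridgement R) a)"
    then show "act (abridgement R) (ident (grpd (abridgement R)) a) x = x"
      using act_ident Lc by (simp add: abridgement_def G.source_ident)
  next
    fix g h x
    assume "g \<in> mor (grpd (abridgement R))" "h \<in> mor (grpd (abridgement R))"
      "source (grpd (abridgement R)) g = target (grpd (abridgement R)) h"
      "x \<in> carrier (bring (abridgement R) (source (grpd (abridgement R)) h))"
    then show "act (abridgement R) (gcomp (grpd (abridgement R)) g h) x =
        act (abridgement R) g (act (abridgement R) h x)"
      using act_comp Lc act_generated_subring
      by (simp add: abridgement_def G.source_comp G.source_closed)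
  next
    fix g assume "g \<in> mor (grpd (abridgement R))"
    then show "cocycle (abridgement R) g
        \<in> carrier (bring (abridgement R) (target (grpd (abridgement R)) g))"
      using NL by (simp add: abridgement_def)
  next
    fix g h
    assume "g \<in> mor (grpd (abridgement R))" "h \<in> mor (grpd (abridgement R))"
      "source (grpd (abridgement R)) g = target (grpd (abridgement R)) h"
    then show "cocycle (abridgement R) (gcomp (grpd (abridgement R)) g h) =
        cocycle (abridgement R) g \<oplus>\<^bsub>bring (abridgement R) (target (grpd (abridgement R)) g)\<^esub>
        act (abridgement R) g (cocycle (abridgement R) h)"
      using cocycle_comp NL by (simp add: abridgement_def)
  qed
qed

definition faithful :: "('o, 'm, 'b) protorootoid \<Rightarrow> bool" where
  "faithful R \<longleftrightarrow> (\<forall>a\<in>ob (grpd R). \<forall>g\<in>morphisms_to (grpd R) a.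
     cocycle R g = \<zero>\<^bsub>bring R a\<^esub> \<longrightarrow> g = ident (grpd R) a)"

definition interval_finite :: "('o, 'm, 'b) protorootoid \<Rightarrow> bool" where
  "interval_finite R \<longleftrightarrow> (\<forall>a\<in>ob (grpd R). \<forall>g\<in>morphisms_to (grpd R) a.
     finite {A \<in> weak_order R a. brng_le (bring R a) A (cocycle R g)})"

definition cocycle_finite :: "('o, 'm, 'b) protorootoid \<Rightarrow> bool" where
  "cocycle_finite R \<longleftrightarrow>
     (\<forall>g\<in>mor (grpd R). finite_rank (bring R (target (grpd R) g)) (cocycle R g))"

definition cocycle_length :: "('o, 'm, 'b) protorootoid \<Rightarrow> 'm \<Rightarrow> nat" where
  "cocycle_length R g = brng_rank (bring R (target (grpd R) g)) (cocycle R g)"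

definition atomic_morphisms :: "('o, 'm, 'b) protorootoid \<Rightarrow> 'm set" where
  "atomic_morphisms R = {s \<in> mor (grpd R).
     is_atom (bring R (target (grpd R) s)) (weak_order R (target (grpd R) s)) (cocycle R s)}"

definition simple_morphisms :: "('o, 'm, 'b) protorootoid \<Rightarrow> 'm set" where
  "simple_morphisms R = {s \<in> mor (grpd R).
     is_atom (bring R (target (grpd R) s)) (carrier (bring R (target (grpd R) s))) (cocycle R s)}"

definition principal_protorootoid :: "('o, 'm, 'b) protorootoid \<Rightarrow> bool" where
  "principal_protorootoid R \<longleftrightarrow> cocycle_finite R \<and> generates (grpd R) (simple_morphisms R) \<and>
     (\<forall>g\<in>mor (grpd R). gen_length (grpd R) (simple_morphisms R) g = cocycle_length R g)"

definition preprincipal_protorootoid :: "('o, 'm, 'b) protorootoid \<Rightarrow> bool" where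
  "preprincipal_protorootoid R \<longleftrightarrow> faithful R \<and> interval_finite R \<and>
     (\<forall>a\<in>ob (grpd R). \<forall>g\<in>morphisms_to (grpd R) a.
        \<forall>s\<in>atomic_morphisms R \<inter> morphisms_to (grpd R) a.
          cocycle R g \<otimes>\<^bsub>bring R a\<^esub> cocycle R s = \<zero>\<^bsub>bring R a\<^esub> \<or>
          brng_le (bring R a) (cocycle R s) (cocycle R g))"

end

theory Submission
  imports Defs
begin

text \<open>For a simple morphism \<open>s\<close> with \<open>N(s) \<subseteq> N(g)\<close> the identity \<open>N(g) = N(s) + sN(s\<^sup>*g)\<close> is a
  disjoint decomposition whose second summand has the same rank as \<open>N(s\<^sup>*g)\<close>, so splitting off
  \<open>s\<close> lowers the rank by exactly one; for arbitrary simple \<open>s\<close> the rank changes by at most one.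

  If \<open>R\<close> is preprincipal and \<open>s\<close> atomic, the elements that contain \<open>N(s)\<close> or are disjoint from it
  form a subring containing the weak order, so \<open>N(s)\<close> is an atom of the ring generated by the
  weak order. Interval finiteness supplies an atomic morphism below each nonzero \<open>N(g)\<close>, and
  the number of elements of the weak order below \<open>N(g)\<close> drops when it is split off, so iterating
  writes \<open>g\<close> as a product of as many simple morphisms as the rank of \<open>N(g)\<close>. Conversely, in a
  principal protorootoid the first factor \<open>s\<close> of a shortest expression of \<open>g\<close> satisfies
  \<open>N(s) \<subseteq> N(g)\<close>, so atomic morphisms are simple. Preprincipality and atomic morphisms depend
  only on the weak orders and hence are unaffected by abridgement.\<close>

section \<open>Rank in Boolean rings\<close>

context boolean_ring
begin

text \<open>The square of \<open>x \<oplus> x\<close> expands to four copies of \<open>x\<close>;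
  cancelling two leaves zero. Addition thus undoes itself, and this replaces subtraction
  below.\<close>

lemma add_self: "x \<in> carrier B \<Longrightarrow> x \<oplus> x = \<zero>"
proof -
  assume x: "x \<in> carrier B"
  have "(x \<oplus> x) \<oplus> (x \<oplus> x) = x \<oplus> x"
    using idem[of "x \<oplus> x"] l_distr[of x x "x \<oplus> x"] r_distr[of x x x] idem[OF x] x m_closed
    by simp
  then show ?thesis using x by (metis a_closed add.r_cancel_one)
qed

lemma mult_zero_left: "x \<in> carrier B \<Longrightarrow> \<zero> \<otimes> x = \<zero>"
  using l_distr[of \<zero> \<zero> x] m_closed[of \<zero> x] by (metis add.r_cancel_one l_zero zero_closed)

lemma mult_zero_right: "x \<in> carrier B \<Longrightarrow> x \<otimes> \<zero> = \<zero>"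
  using r_distr[of \<zero> \<zero> x] m_closed[of x \<zero>] by (metis add.r_cancel_one l_zero zero_closed)

lemma add_eq_zero: "\<lbrakk>x \<in> carrier B; y \<in> carrier B; x \<oplus> y = \<zero>\<rbrakk> \<Longrightarrow> x = y"
  using a_assoc[of x y y] add_self[of y] by simp

lemma add_cancel_left: "\<lbrakk>x \<in> carrier B; y \<in> carrier B\<rbrakk> \<Longrightarrow> x \<oplus> (x \<oplus> y) = y"
  using a_assoc[of x x y] add_self by simp

text \<open>Expanding the square of \<open>x \<oplus> y\<close> leaves
  \<open>x \<otimes> y \<oplus> y \<otimes> x = \<zero>\<close>, which characteristic two turns into
  an equality.\<close>

lemma mult_comm:
  assumes x: "x \<in> carrier B" and y: "y \<in> carrier B"
  shows "x \<otimes> y = y \<otimes> x"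
proof -
  have c: "x \<otimes> y \<in> carrier B" "y \<otimes> x \<in> carrier B" using x y m_closed by auto
  have "x \<oplus> y = (x \<oplus> y) \<otimes> (x \<oplus> y)" using x y by (simp only: idem a_closed)
  also have "\<dots> = (x \<oplus> y \<otimes> x) \<oplus> (x \<otimes> y \<oplus> y)"
    using x y by (simp add: l_distr r_distr idem[OF x] idem[OF y])
  also have "\<dots> = (x \<otimes> y \<oplus> y \<otimes> x) \<oplus> (x \<oplus> y)"
    using x y c by (simp add: a_ac)
  finally have eq: "x \<oplus> y = (x \<otimes> y \<oplus> y \<otimes> x) \<oplus> (x \<oplus> y)" .
  have "x \<otimes> y \<oplus> y \<otimes> x = ((x \<otimes> y \<oplus> y \<otimes> x) \<oplus> (x \<oplus> y)) \<oplus> (x \<oplus> y)"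
    using a_assoc[of "x \<otimes> y \<oplus> y \<otimes> x" "x \<oplus> y" "x \<oplus> y"] add_self[of "x \<oplus> y"] x y c by simp
  also have "\<dots> = \<zero>" unfolding eq[symmetric] using add_self x y by simp
  finally have "x \<otimes> y \<oplus> y \<otimes> x = \<zero>" .
  then show ?thesis using add_eq_zero c by blast
qed

lemma le_trans:
  "\<lbrakk>x \<in> carrier B; y \<in> carrier B; z \<in> carrier B; brng_le B x y; brng_le B y z\<rbrakk> \<Longrightarrow> brng_le B x z"
  unfolding brng_le_def by (metis m_assoc)

lemma le_antisym:
  "\<lbrakk>x \<in> carrier B; y \<in> carrier B; brng_le B x y; brng_le B y x\<rbrakk> \<Longrightarrow> x = y"
  unfolding brng_le_def by (metis mult_comm)

text \<open>The product lies below \<open>e\<close>. For atoms of the ring this dichotomy is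
  automatic; for atomic morphisms it is the last clause of
  \<open>preprincipal_protorootoid\<close>.\<close>

lemma atom_mult:
  assumes e: "is_atom B (carrier B) e" and x: "x \<in> carrier B"
  shows "x \<otimes> e = \<zero> \<or> x \<otimes> e = e"
proof -
  have ec: "e \<in> carrier B" using e by (simp add: is_atom_def)
  have "brng_le B (x \<otimes> e) e" using m_assoc[OF x ec ec] idem[OF ec] by (simp add: brng_le_def)
  then show ?thesis using e m_closed[OF x ec] by (simp add: is_atom_def)
qed

lemma finite_rank_zero: "finite_rank B \<zero>"
proof -
  have "brng_down B \<zero> \<subseteq> {\<zero>}" using mult_zero_right by (auto simp: brng_down_def brng_le_def)
  then show ?thesis unfolding finite_rank_def by (rule finite_subset) simp
qed

lemma brng_rank_zero: "brng_rank B \<zero> = 0"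
proof -
  have "{y \<in> brng_down B \<zero>. is_atom B (carrier B) y} = {}"
    using mult_zero_right by (auto simp: brng_down_def brng_le_def is_atom_def)
  then show ?thesis unfolding brng_rank_def by (metis card.empty)
qed

text \<open>An element \<open>y\<close> below the sum is
  \<open>y \<otimes> x \<oplus> y \<otimes> e\<close>, whose second summand is
  \<open>\<zero>\<close> or \<open>e\<close>, so at most twice as many elements lie below the sum as
  below \<open>x\<close>.\<close>

lemma finite_rank_add_atom:
  assumes e: "is_atom B (carrier B) e" and x: "x \<in> carrier B" and fin: "finite_rank B x"
  shows "finite_rank B (x \<oplus> e)"
proof -
  have ec: "e \<in> carrier B" using e by (simp add: is_atom_def)
  have "brng_down B (x \<oplus> e) \<subseteq> brng_down B x \<union> (\<lambda>y. y \<oplus> e) ` brng_down B x"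
  proof
    fix y assume "y \<in> brng_down B (x \<oplus> e)"
    then have y: "y \<in> carrier B" "y \<otimes> (x \<oplus> e) = y" by (auto simp: brng_down_def brng_le_def)
    then have eq: "y = y \<otimes> x \<oplus> y \<otimes> e" using r_distr x ec by simp
    have yx: "y \<otimes> x \<in> brng_down B x"
      using y x m_assoc[of y x x] idem m_closed by (simp add: brng_down_def brng_le_def)
    then have c: "y \<otimes> x \<in> carrier B" by (simp add: brng_down_def)
    show "y \<in> brng_down B x \<union> (\<lambda>y. y \<oplus> e) ` brng_down B x"
      using atom_mult[OF e y(1)] eq yx c by (metis UnI1 UnI2 imageI r_zero)
  qed
  then show ?thesis using fin by (auto simp: finite_rank_def intro: finite_subset)
qed

text \<open>Distinct atoms are disjoint, so \<open>e\<close> contributes nothing to the product with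
  \<open>y\<close>.\<close>

lemma atom_le_add_atom_iff:
  assumes e: "is_atom B (carrier B) e" and x: "x \<in> carrier B"
    and y: "is_atom B (carrier B) y" and ne: "y \<noteq> e"
  shows "brng_le B y (x \<oplus> e) \<longleftrightarrow> brng_le B y x"
proof -
  have c: "e \<in> carrier B" "y \<in> carrier B" using e y by (simp_all add: is_atom_def)
  have "y \<otimes> e = \<zero>"
    using atom_mult[OF e c(2)] atom_mult[OF y c(1)] mult_comm[OF c] ne by metis
  then have "y \<otimes> (x \<oplus> e) = y \<otimes> x" using r_distr[OF x c(1) c(2)] m_closed[OF c(2) x] by simp
  then show ?thesis by (simp add: brng_le_def)
qed

text \<open>If \<open>e\<close> already lies below \<open>x\<close>, adding it removes it, so in
  general only an upper bound remains.\<close>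

lemma brng_rank_add_atom_le:
  assumes e: "is_atom B (carrier B) e" and x: "x \<in> carrier B" and fin: "finite_rank B x"
  shows "brng_rank B (x \<oplus> e) \<le> Suc (brng_rank B x)"
proof -
  have "{y \<in> brng_down B (x \<oplus> e). is_atom B (carrier B) y} \<subseteq>
      insert e {y \<in> brng_down B x. is_atom B (carrier B) y}"
    using atom_le_add_atom_iff[OF e x] by (auto simp: brng_down_def)
  then have "brng_rank B (x \<oplus> e) \<le> card (insert e {y \<in> brng_down B x. is_atom B (carrier B) y})"
    unfolding brng_rank_def using fin by (intro card_mono) (auto simp: finite_rank_def)
  also have "\<dots> \<le> Suc (brng_rank B x)"
    unfolding brng_rank_def using fin by (intro card_insert_le_m1) auto
  finally show ?thesis .
qed

text \<open>Disjointness puts \<open>e\<close> below the sum but not below \<open>x\<close>, making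
  it the one new atom.\<close>

lemma brng_rank_add_atom:
  assumes e: "is_atom B (carrier B) e" and x: "x \<in> carrier B" and fin: "finite_rank B x"
    and disj: "x \<otimes> e = \<zero>"
  shows "brng_rank B (x \<oplus> e) = Suc (brng_rank B x)"
proof -
  have ec: "e \<in> carrier B" and e0: "e \<noteq> \<zero>" using e by (auto simp: is_atom_def)
  have ex: "e \<otimes> x = \<zero>" using disj mult_comm[OF x ec] by simp
  have "brng_le B e (x \<oplus> e)" "\<not> brng_le B e x"
    using r_distr[OF x ec ec] ex idem[OF ec] ec e0 by (auto simp: brng_le_def)
  then have "{y \<in> brng_down B (x \<oplus> e). is_atom B (carrier B) y} =
      insert e {y \<in> brng_down B x. is_atom B (carrier B) y}"
    "e \<notin> {y \<in> brng_down B x. is_atom B (carrier B) y}"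
    using atom_le_add_atom_iff[OF e x] e ec by (auto simp: brng_down_def)
  then show ?thesis
    unfolding brng_rank_def using fin by (simp add: finite_rank_def)
qed

end

section \<open>Transport of atoms and rank along ring isomorphisms\<close>

lemma brng_hom_zero:
  assumes "boolean_ring B" "boolean_ring C" "f \<in> brng_hom B C"
  shows "f \<zero>\<^bsub>B\<^esub> = \<zero>\<^bsub>C\<^esub>"
proof -
  interpret B: boolean_ring B by fact
  interpret C: boolean_ring C by fact
  interpret f: group_hom "add_monoid B" "add_monoid C" f
    using assms(3) B.a_group C.a_group
    by (simp add: group_hom_def group_hom_axioms_def brng_hom_def)
  show ?thesis using f.hom_one by simp
qed

text \<open>Injectivity makes the homomorphism reflect the order as well as preserve it;
  surjectivity makes every candidate below an image an image itself.\<close>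

lemma
  assumes B: "boolean_ring B" and C: "boolean_ring C" and f: "f \<in> brng_hom B C"
    and bij: "bij_betw f (carrier B) (carrier C)"
  shows brng_iso_is_atom:
      "y \<in> carrier B \<Longrightarrow> is_atom C (carrier C) (f y) \<longleftrightarrow> is_atom B (carrier B) y"
    and brng_iso_finite_rank: "x \<in> carrier B \<Longrightarrow> finite_rank C (f x) \<longleftrightarrow> finite_rank B x"
    and brng_iso_rank: "x \<in> carrier B \<Longrightarrow> brng_rank C (f x) = brng_rank B x"
proof -
  interpret B: boolean_ring B by fact
  interpret C: boolean_ring C by fact
  have inj: "f x = f y \<longleftrightarrow> x = y" if "x \<in> carrier B" "y \<in> carrier B" for x y
    using bij that by (auto simp: bij_betw_def inj_on_def)
  have im: "carrier C = f ` carrier B" using bij by (simp add: bij_betw_def)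
  have z: "f \<zero>\<^bsub>B\<^esub> = \<zero>\<^bsub>C\<^esub>" by (rule brng_hom_zero[OF B C f])
  have le: "brng_le C (f x) (f y) \<longleftrightarrow> brng_le B x y" if "x \<in> carrier B" "y \<in> carrier B" for x y
  proof -
    have "f (x \<otimes>\<^bsub>B\<^esub> y) = f x \<otimes>\<^bsub>C\<^esub> f y" using f that by (auto simp: brng_hom_def hom_def)
    then show ?thesis using inj[of "x \<otimes>\<^bsub>B\<^esub> y" x] that B.m_closed by (simp add: brng_le_def)
  qed
  have eq0: "f x = \<zero>\<^bsub>C\<^esub> \<longleftrightarrow> x = \<zero>\<^bsub>B\<^esub>" if "x \<in> carrier B" for x
    using inj[OF that B.zero_closed] z by simp
  have atom: "is_atom C (carrier C) (f y) \<longleftrightarrow> is_atom B (carrier B) y" if "y \<in> carrier B" for y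
    using that by (simp add: is_atom_def im inj le eq0)
  then show "y \<in> carrier B \<Longrightarrow> is_atom C (carrier C) (f y) \<longleftrightarrow> is_atom B (carrier B) y" .
  assume x: "x \<in> carrier B"
  have down: "brng_down C (f x) = f ` brng_down B x"
    using le x by (auto simp: brng_down_def im)
  have injd: "inj_on f (brng_down B x)"
    using bij by (auto simp: bij_betw_def brng_down_def intro: inj_on_subset)
  show "finite_rank C (f x) \<longleftrightarrow> finite_rank B x"
    unfolding finite_rank_def down by (rule finite_image_iff[OF injd])
  have "{y \<in> brng_down C (f x). is_atom C (carrier C) y} =
      f ` {y \<in> brng_down B x. is_atom B (carrier B) y}"
    unfolding down using atom by (auto simp: brng_down_def)
  then show "brng_rank C (f x) = brng_rank B x"
    unfolding brng_rank_def using inj_on_subset[OF injd] by (simp add: card_image)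
qed

section \<open>Products in groupoids\<close>

context groupoid
begin

text \<open>Inverses are unique by \<open>k = k(gh) = (kg)h = h\<close>, which justifies the
  definite description in \<open>ginv\<close>.\<close>

lemma ginv:
  assumes g: "g \<in> mor G"
  shows ginv_closed: "ginv G g \<in> mor G"
    and source_ginv: "source G (ginv G g) = target G g"
    and target_ginv: "target G (ginv G g) = source G g"
    and ginv_comp: "gcomp G (ginv G g) g = ident G (source G g)"
    and comp_ginv: "gcomp G g (ginv G g) = ident G (target G g)"
proof -
  let ?P = "\<lambda>h. h \<in> mor G \<and> source G h = target G g \<and> target G h = source G g \<and>
     gcomp G h g = ident G (source G g) \<and> gcomp G g h = ident G (target G g)"
  obtain h where h: "?P h" using inverse_ex[OF g] by blast
  have "k = h" if k: "?P k" for k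
  proof -
    have "k = gcomp G k (gcomp G g h)" using comp_ident_right[of k] h k by simp
    also have "\<dots> = gcomp G (gcomp G k g) h" using comp_assoc[of k g h] h k g by simp
    also have "\<dots> = h" using comp_ident_left[of h] h k by simp
    finally show ?thesis .
  qed
  then have "?P (ginv G g)" unfolding ginv_def using h by (rule theI[where P = ?P, rotated])
  then show "ginv G g \<in> mor G" "source G (ginv G g) = target G g"
    "target G (ginv G g) = source G g" "gcomp G (ginv G g) g = ident G (source G g)"
    "gcomp G g (ginv G g) = ident G (target G g)" by auto
qed

lemma comp_ginv_comp:
  assumes "g \<in> mor G" "h \<in> mor G" "target G g = target G h"
  shows "gcomp G g (gcomp G (ginv G g) h) = h"
  using comp_assoc[of g "ginv G g" h] ginv[OF assms(1)] comp_ident_left[OF assms(2)] assms by simp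

lemma is_product_mor:
  assumes "T \<subseteq> mor G" "is_product G T g gs"
  shows "g \<in> mor G \<and> target G g = target G (hd gs)"
  using assms(2)
proof (induction gs arbitrary: g)
  case Nil
  then show ?case by (simp add: is_product_def)
next
  case (Cons h gs)
  show ?case
  proof (cases gs)
    case Nil
    then show ?thesis using Cons.prems assms(1) by (auto simp: is_product_def)
  next
    case gs: (Cons k ks)
    have "is_product G T (comp_list G gs) gs" using Cons.prems gs by (auto simp: is_product_def)
    then have "comp_list G gs \<in> mor G \<and> target G (comp_list G gs) = target G k"
      using Cons.IH gs by simp
    then show ?thesis
      using Cons.prems assms(1) gs comp_closed target_comp by (auto simp: is_product_def)
  qed
qed

text \<open>Lets arguments peel off the first factor. The tail must be nonempty because
  \<open>is_product\<close> rejects the empty list; one-letter products are treated apart.\<close>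

lemma is_product_Cons:
  assumes "T \<subseteq> mor G" "gs \<noteq> []"
  shows "is_product G T g (s # gs) \<longleftrightarrow>
    s \<in> T \<and> (\<exists>h. is_product G T h gs \<and> source G s = target G h \<and> g = gcomp G s h)"
proof -
  obtain k ks where gs: "gs = k # ks" using assms(2) by (cases gs) auto
  show ?thesis
    using is_product_mor[OF assms(1), of "comp_list G gs" gs] unfolding gs
    by (auto simp: is_product_def)
qed

text \<open>This covers identities too, whose length is zero by definition.\<close>

lemma gen_length_le:
  "is_product G (S \<union> ginv G ` S) g gs \<Longrightarrow> gen_length G S g \<le> length gs"
  by (auto simp: gen_length_def intro: Least_le)

lemma gen_length_product:
  assumes "generates G S" "g \<in> mor G" "g \<notin> ident G ` ob G"
  obtains gs where "is_product G (S \<union> ginv G ` S) g gs" "length gs = gen_length G S g"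
proof -
  obtain gs where "is_product G (S \<union> ginv G ` S) g gs" using assms unfolding generates_def by blast
  then have "\<exists>hs. is_product G (S \<union> ginv G ` S) g hs \<and> length hs = gen_length G S g"
    unfolding gen_length_def using assms(3) by simp (rule LeastI_ex, blast)
  then show ?thesis using that by blast
qed

end

section \<open>Simple morphisms\<close>

context protorootoid
begin

sublocale G: groupoid "grpd R" by (rule grpd)

abbreviation "src \<equiv> source (grpd R)"
abbreviation "tgt \<equiv> target (grpd R)"
abbreviation "cmp \<equiv> gcomp (grpd R)"
abbreviation "invm \<equiv> ginv (grpd R)"
abbreviation "ids \<equiv> ident (grpd R) ` ob (grpd R)"

section \<open>Morphisms acting as ring isomorphisms\<close>

lemma ring_target: "g \<in> mor (grpd R) \<Longrightarrow> boolean_ring (bring R (tgt g))"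
  and ring_source: "g \<in> mor (grpd R) \<Longrightarrow> boolean_ring (bring R (src g))"
  using bring G.target_closed G.source_closed by auto

lemma act_closed:
  "\<lbrakk>g \<in> mor (grpd R); x \<in> carrier (bring R (src g))\<rbrakk> \<Longrightarrow> act R g x \<in> carrier (bring R (tgt g))"
  using act_hom by (auto simp: brng_hom_def hom_def)

lemma act_mult:
  "\<lbrakk>g \<in> mor (grpd R); x \<in> carrier (bring R (src g)); y \<in> carrier (bring R (src g))\<rbrakk>
    \<Longrightarrow> act R g (x \<otimes>\<^bsub>bring R (src g)\<^esub> y) = act R g x \<otimes>\<^bsub>bring R (tgt g)\<^esub> act R g y"
  using act_hom by (auto simp: brng_hom_def hom_def)

lemma act_ginv_act:
  "\<lbrakk>g \<in> mor (grpd R); x \<in> carrier (bring R (src g))\<rbrakk> \<Longrightarrow> act R (invm g) (act R g x) = x"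
  using act_comp[of "invm g" g x] G.ginv[of g] act_ident[of "src g" x] G.source_closed by simp

lemma act_act_ginv:
  "\<lbrakk>g \<in> mor (grpd R); x \<in> carrier (bring R (tgt g))\<rbrakk> \<Longrightarrow> act R g (act R (invm g) x) = x"
  using act_comp[of g "invm g" x] G.ginv[of g] act_ident[of "tgt g" x] G.target_closed by simp

lemma act_bij:
  assumes g: "g \<in> mor (grpd R)"
  shows "bij_betw (act R g) (carrier (bring R (src g))) (carrier (bring R (tgt g)))"
proof (rule bij_betw_byWitness[where f' = "act R (invm g)"])
  show "act R (invm g) ` carrier (bring R (tgt g)) \<subseteq> carrier (bring R (src g))"
    using act_closed[of "invm g"] G.ginv[OF g] by auto
qed (use act_ginv_act act_act_ginv act_closed g in auto)

text \<open>By functoriality the action of \<open>invm g\<close> inverts that of \<open>g\<close>,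
  so rank may be computed in the ring at either end of \<open>g\<close>.\<close>

lemma
  assumes g: "g \<in> mor (grpd R)" and x: "x \<in> carrier (bring R (src g))"
  shows is_atom_act: "is_atom (bring R (tgt g)) (carrier (bring R (tgt g))) (act R g x) \<longleftrightarrow>
      is_atom (bring R (src g)) (carrier (bring R (src g))) x"
    and finite_rank_act:
      "finite_rank (bring R (tgt g)) (act R g x) \<longleftrightarrow> finite_rank (bring R (src g)) x"
    and rank_act: "brng_rank (bring R (tgt g)) (act R g x) = brng_rank (bring R (src g)) x"
proof -
  note iso = ring_source[OF g] ring_target[OF g] act_hom[OF g] act_bij[OF g] x
  show "is_atom (bring R (tgt g)) (carrier (bring R (tgt g))) (act R g x) \<longleftrightarrow>
      is_atom (bring R (src g)) (carrier (bring R (src g))) x"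
    and "finite_rank (bring R (tgt g)) (act R g x) \<longleftrightarrow> finite_rank (bring R (src g)) x"
    and "brng_rank (bring R (tgt g)) (act R g x) = brng_rank (bring R (src g)) x"
    by (rule brng_iso_is_atom[OF iso] brng_iso_finite_rank[OF iso] brng_iso_rank[OF iso])+
qed

text \<open>The cocycle condition for \<open>1 = 1 1\<close> makes the value equal to its own
  double, which is zero.\<close>

lemma cocycle_ident:
  assumes a: "a \<in> ob (grpd R)"
  shows "cocycle R (ident (grpd R) a) = \<zero>\<^bsub>bring R a\<^esub>"
proof -
  interpret boolean_ring "bring R a" by (rule bring[OF a])
  let ?i = "ident (grpd R) a"
  have i: "?i \<in> mor (grpd R)" "src ?i = a" "tgt ?i = a"
    using G.ident_closed G.source_ident G.target_ident a by auto
  then have c: "cocycle R ?i \<in> carrier (bring R a)" using cocycle_closed by force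
  have "cocycle R ?i = cocycle R ?i \<oplus>\<^bsub>bring R a\<^esub> cocycle R ?i"
    using cocycle_comp[of ?i ?i] i G.comp_ident_left[of ?i] act_ident[OF a c] by simp
  then show ?thesis using add_self[OF c] by simp
qed

text \<open>The cocycle condition for \<open>g = s(s* g)\<close>, with \<open>N(s)\<close> moved
  across in characteristic two. It governs every splitting off of a first factor.\<close>

lemma cocycle_comp_ginv:
  assumes s: "s \<in> mor (grpd R)" and g: "g \<in> mor (grpd R)" and t: "tgt g = tgt s"
  shows "act R s (cocycle R (cmp (invm s) g)) =
    cocycle R g \<oplus>\<^bsub>bring R (tgt s)\<^esub> cocycle R s"
proof -
  interpret boolean_ring "bring R (tgt s)" by (rule ring_target[OF s])
  let ?h = "cmp (invm s) g"
  have h: "?h \<in> mor (grpd R)" "tgt ?h = src s"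
    using G.comp_closed[of "invm s" g] G.target_comp[of "invm s" g] G.ginv[OF s] g t by auto
  have Ns: "cocycle R s \<in> carrier (bring R (tgt s))" by (rule cocycle_closed[OF s])
  have sh: "act R s (cocycle R ?h) \<in> carrier (bring R (tgt s))"
    using act_closed[OF s] cocycle_closed[OF h(1)] h(2) by simp
  have "cocycle R g = cocycle R s \<oplus>\<^bsub>bring R (tgt s)\<^esub> act R s (cocycle R ?h)"
    using cocycle_comp[OF s h(1)] h(2) G.comp_ginv_comp[OF s g] t by simp
  then show ?thesis using add_cancel_left[OF Ns sh] a_comm Ns sh by simp
qed

lemma cocycle_ginv:
  assumes s: "s \<in> mor (grpd R)"
  shows "act R s (cocycle R (invm s)) = cocycle R s"
proof -
  interpret boolean_ring "bring R (tgt s)" by (rule ring_target[OF s])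
  let ?i = "ident (grpd R) (tgt s)"
  have o: "tgt s \<in> ob (grpd R)" by (rule G.target_closed[OF s])
  then have i: "?i \<in> mor (grpd R)" "tgt ?i = tgt s"
    using G.ident_closed G.target_ident by auto
  have "cmp (invm s) ?i = invm s"
    using G.comp_ident_right[of "invm s"] G.ginv[OF s] by simp
  then show ?thesis
    using cocycle_comp_ginv[OF s i] cocycle_ident[OF o] cocycle_closed[OF s] by simp
qed

lemma simple_mor: "simple_morphisms R \<subseteq> mor (grpd R)"
  by (auto simp: simple_morphisms_def)

lemma simple_ginv:
  assumes "s \<in> simple_morphisms R"
  shows "invm s \<in> simple_morphisms R"
proof -
  have s: "s \<in> mor (grpd R)" using assms simple_mor by blast
  have "cocycle R (invm s) \<in> carrier (bring R (src s))"
    using cocycle_closed[of "invm s"] G.ginv[OF s] by simp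
  then show ?thesis
    using is_atom_act[OF s, of "cocycle R (invm s)"] assms G.ginv[OF s]
    by (simp add: simple_morphisms_def cocycle_ginv)
qed

lemma simple_Un_ginv: "simple_morphisms R \<union> invm ` simple_morphisms R = simple_morphisms R"
  using simple_ginv by auto

text \<open>An atom of the whole ring that lies in a subposet is an atom of the subposet.\<close>

lemma simple_subset_atomic: "simple_morphisms R \<subseteq> atomic_morphisms R"
  using weak_order_subset_carrier
  by (fastforce simp: simple_morphisms_def atomic_morphisms_def is_atom_def weak_order_def
      morphisms_to_def)

lemma cocycle_length_ident: "g \<in> ids \<Longrightarrow> cocycle_length R g = 0"
  using boolean_ring.brng_rank_zero[OF bring]
  by (auto simp: cocycle_length_def cocycle_ident G.target_ident)

section \<open>From principal to preprincipal\<close>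

text \<open>If \<open>N(s)\<close> were disjoint from \<open>N(g)\<close>, passing from \<open>g\<close> to \<open>s\<^sup>*g\<close> would
  increase the rank, whereas it decreases the length when \<open>s\<close> is the first factor of a shortest
  expression of \<open>g\<close>.\<close>

lemma principal_atomic_subset_simple:
  assumes "principal_protorootoid R"
  shows "atomic_morphisms R \<subseteq> simple_morphisms R"
proof
  fix g assume g: "g \<in> atomic_morphisms R"
  let ?S = "simple_morphisms R" and ?B = "bring R (tgt g)"
  have gm: "g \<in> mor (grpd R)" and atom: "is_atom ?B (weak_order R (tgt g)) (cocycle R g)"
    using g by (auto simp: atomic_morphisms_def)
  interpret boolean_ring ?B by (rule ring_target[OF gm])
  have cf: "cocycle_finite R" and gen: "generates (grpd R) ?S"
    and len: "\<And>k. k \<in> mor (grpd R) \<Longrightarrow> gen_length (grpd R) ?S k = cocycle_length R k"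
    using assms by (auto simp: principal_protorootoid_def)
  have ng: "g \<notin> ids"
    using atom cocycle_ident G.target_ident by (auto simp: is_atom_def)
  obtain gs where gs: "is_product (grpd R) ?S g gs" "length gs = cocycle_length R g"
    using G.gen_length_product[OF gen gm ng] len[OF gm] simple_Un_ginv by metis
  then obtain s hs where shs: "gs = s # hs" by (cases gs) (auto simp: is_product_def)
  have s: "s \<in> ?S" using gs shs by (auto simp: is_product_def)
  have sm: "s \<in> mor (grpd R)" using s simple_mor by blast
  have st: "tgt g = tgt s" using G.is_product_mor[OF simple_mor gs(1)] shs by simp
  have satom: "is_atom ?B (carrier ?B) (cocycle R s)"
    using s st by (simp add: simple_morphisms_def)
  have Ng: "cocycle R g \<in> carrier ?B" by (rule cocycle_closed[OF gm])
  have Ns: "cocycle R s \<in> carrier ?B" using cocycle_closed[OF sm] st by simp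
  show "g \<in> ?S"
  proof (cases "hs = []")
    case True
    then show ?thesis using gs shs s by (simp add: is_product_def)
  next
    case False
    then obtain h where h: "is_product (grpd R) ?S h hs" "src s = tgt h" "g = cmp s h"
      using G.is_product_Cons[OF simple_mor] gs shs by metis
    have hm: "h \<in> mor (grpd R)" using G.is_product_mor[OF simple_mor h(1)] by simp
    \<comment> \<open>The tail need not be known to be shortest: an upper bound already makes the
      length of \<open>h\<close> drop below that of \<open>g\<close>.\<close>
    have "cocycle_length R h \<le> length hs"
      using G.gen_length_le[of ?S h hs] simple_Un_ginv h(1) len[OF hm] by simp
    then have lt: "cocycle_length R h < cocycle_length R g" using gs shs by simp
    have Nh: "cocycle R h \<in> carrier (bring R (src s))" using cocycle_closed[OF hm] h by simp
    have sh: "act R s (cocycle R h) \<in> carrier ?B" using act_closed[OF sm Nh] st by simp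
    have "cocycle R g = cocycle R s \<oplus>\<^bsub>?B\<^esub> act R s (cocycle R h)"
      using cocycle_comp[OF sm hm h(2)] h(3) st by simp
    then have eq: "act R s (cocycle R h) = cocycle R g \<oplus>\<^bsub>?B\<^esub> cocycle R s"
      using add_cancel_left[OF Ns sh] a_comm Ns sh by simp
    have rk: "brng_rank ?B (act R s (cocycle R h)) = cocycle_length R h"
      using rank_act[OF sm Nh] h(2) st by (simp add: cocycle_length_def)
    have "cocycle R g \<otimes>\<^bsub>?B\<^esub> cocycle R s \<noteq> \<zero>\<^bsub>?B\<^esub>"
    proof
      assume "cocycle R g \<otimes>\<^bsub>?B\<^esub> cocycle R s = \<zero>\<^bsub>?B\<^esub>"
      then have "cocycle_length R h = Suc (cocycle_length R g)"
        using brng_rank_add_atom[OF satom Ng] cf gm eq rk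
        by (simp add: cocycle_finite_def cocycle_length_def)
      then show False using lt by simp
    qed
    then have "cocycle R g \<otimes>\<^bsub>?B\<^esub> cocycle R s = cocycle R s" using atom_mult[OF satom Ng] by blast
    then have "brng_le ?B (cocycle R s) (cocycle R g)"
      using mult_comm[OF Ng Ns] by (simp add: brng_le_def)
    moreover have "cocycle R s \<in> weak_order R (tgt g)"
      using sm st by (auto simp: weak_order_def morphisms_to_def)
    \<comment> \<open>\<open>N(s)\<close> is a nonzero element of the weak order below the atom
      \<open>N(g)\<close>. Simplicity depends only on the cocycle value, so \<open>s\<close> and
      \<open>g\<close> need not be identified.\<close>
    ultimately have "cocycle R s = cocycle R g"
      using atom satom by (auto simp: is_atom_def)
    then show ?thesis using satom gm by (simp add: simple_morphisms_def)
  qed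
qed

text \<open>Intervals of the weak order sit inside finite intervals of the ring, and the last clause
  is \<open>atom_mult\<close>, available because atomic morphisms are simple.\<close>

lemma principal_imp_preprincipal:
  assumes "principal_protorootoid R"
  shows "preprincipal_protorootoid R"
proof -
  let ?S = "simple_morphisms R"
  have cf: "cocycle_finite R" and gen: "generates (grpd R) ?S"
    and len: "\<And>k. k \<in> mor (grpd R) \<Longrightarrow> gen_length (grpd R) ?S k = cocycle_length R k"
    using assms by (auto simp: principal_protorootoid_def)
  show ?thesis
    unfolding preprincipal_protorootoid_def
  proof (intro conjI ballI)
    show "faithful R"
      unfolding faithful_def
    proof (intro ballI impI)
      fix a g assume a: "a \<in> ob (grpd R)" "g \<in> morphisms_to (grpd R) a"
        and z: "cocycle R g = \<zero>\<^bsub>bring R a\<^esub>"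
      then have g: "g \<in> mor (grpd R)" "tgt g = a" by (auto simp: morphisms_to_def)
      have "cocycle_length R g = 0"
        using boolean_ring.brng_rank_zero[OF bring[OF a(1)]] z g by (simp add: cocycle_length_def)
      then have "gen_length (grpd R) ?S g = 0" using len g by simp
      \<comment> \<open>Products are nonempty lists, so length zero leaves only identities.\<close>
      then have "g \<in> ids"
        using G.gen_length_product[OF gen g(1)] by (metis is_product_def length_0_conv)
      then show "g = ident (grpd R) a" using g G.target_ident by auto
    qed
    show "interval_finite R"
      unfolding interval_finite_def
    proof (intro ballI)
      fix a g assume a: "a \<in> ob (grpd R)" "g \<in> morphisms_to (grpd R) a"
      have "finite (brng_down (bring R a) (cocycle R g))"
        using cf a by (auto simp: cocycle_finite_def finite_rank_def morphisms_to_def)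
      then show "finite {A \<in> weak_order R a. brng_le (bring R a) A (cocycle R g)}"
        by (rule finite_subset[rotated])
          (use weak_order_subset_carrier in \<open>auto simp: brng_down_def\<close>)
    qed
    fix a g s
    assume a: "a \<in> ob (grpd R)" and g: "g \<in> morphisms_to (grpd R) a"
      and s: "s \<in> atomic_morphisms R \<inter> morphisms_to (grpd R) a"
    interpret boolean_ring "bring R a" by (rule bring[OF a])
    have gc: "cocycle R g \<in> carrier (bring R a)"
      using g cocycle_closed by (auto simp: morphisms_to_def)
    have sa: "is_atom (bring R a) (carrier (bring R a)) (cocycle R s)"
      using s principal_atomic_subset_simple[OF assms]
      by (auto simp: morphisms_to_def simple_morphisms_def)
    then have "cocycle R s \<in> carrier (bring R a)" by (simp add: is_atom_def)
    then show "cocycle R g \<otimes>\<^bsub>bring R a\<^esub> cocycle R s = \<zero>\<^bsub>bring R a\<^esub> \<or>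
        brng_le (bring R a) (cocycle R s) (cocycle R g)"
      using atom_mult[OF sa gc] mult_comm[OF gc] by (auto simp: brng_le_def)
  qed
qed

section \<open>Splitting off atomic morphisms\<close>

text \<open>Among the nonzero elements of the weak order below \<open>N(g)\<close>, take
  \<open>x\<close> with the smallest interval. A nonzero element strictly below \<open>x\<close>
  would have a smaller one, lacking at least \<open>x\<close>.\<close>

lemma atomic_below:
  assumes fin: "interval_finite R" and g: "g \<in> mor (grpd R)"
    and nz: "cocycle R g \<noteq> \<zero>\<^bsub>bring R (tgt g)\<^esub>"
  obtains s where "s \<in> atomic_morphisms R" "tgt s = tgt g"
    "brng_le (bring R (tgt g)) (cocycle R s) (cocycle R g)"
proof -
  let ?B = "bring R (tgt g)" and ?W = "weak_order R (tgt g)"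
  interpret boolean_ring ?B by (rule ring_target[OF g])
  have WB: "\<And>x. x \<in> ?W \<Longrightarrow> x \<in> carrier ?B" using weak_order_subset_carrier by blast
  let ?D = "\<lambda>x. {A \<in> ?W. brng_le ?B A x}"
  let ?P = "\<lambda>x. x \<in> ?W \<and> x \<noteq> \<zero>\<^bsub>?B\<^esub> \<and> brng_le ?B x (cocycle R g)"
  have finD: "finite (?D x)" if "x \<in> ?W" for x
    using fin that g G.target_closed[OF g]
    by (auto simp: interval_finite_def weak_order_def morphisms_to_def)
  have Ng: "cocycle R g \<in> ?W" using g by (auto simp: weak_order_def morphisms_to_def)
  have "?P (cocycle R g)" using Ng nz idem[OF WB[OF Ng]] by (simp add: brng_le_def)
  then obtain x where x: "?P x" and least: "\<And>y. ?P y \<Longrightarrow> card (?D x) \<le> card (?D y)"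
    using ex_has_least_nat[of ?P _ "\<lambda>x. card (?D x)"] by blast
  obtain s where s: "s \<in> mor (grpd R)" "tgt s = tgt g" "x = cocycle R s"
    using x by (auto simp: weak_order_def morphisms_to_def)
  have "y = \<zero>\<^bsub>?B\<^esub> \<or> y = x" if y: "y \<in> ?W" "brng_le ?B y x" for y
  proof (rule ccontr)
    assume n: "\<not> (y = \<zero>\<^bsub>?B\<^esub> \<or> y = x)"
    have Py: "?P y" using y n x le_trans[of y x "cocycle R g"] WB Ng by simp
    have "?D y \<subseteq> ?D x" using y x le_trans[of _ y x] WB by blast
    moreover have "x \<in> ?D x" "x \<notin> ?D y"
      using x y n idem[of x] WB le_antisym[of x y] by (auto simp: brng_le_def)
    ultimately have "card (?D y) < card (?D x)"
      using finD x by (intro psubset_card_mono) auto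
    then show False using least[OF Py] by simp
  qed
  then have "s \<in> atomic_morphisms R" using x s by (simp add: atomic_morphisms_def is_atom_def)
  then show ?thesis using that s x by blast
qed

text \<open>Its cardinality is the induction measure of \<open>preprincipal_product\<close>:
  interval finiteness makes it finite before any rank is known to be.\<close>

definition weak_interval :: "'m \<Rightarrow> 'b set" where
  "weak_interval g = {A \<in> weak_order R (tgt g). brng_le (bring R (tgt g)) A (cocycle R g)}"

text \<open>\<open>A \<mapsto> N(s) + sA\<close> embeds the interval below \<open>N(s\<^sup>*g)\<close> into the interval below \<open>N(g)\<close>
  and misses \<open>\<zero>\<close>.\<close>

lemma card_weak_interval_less:
  assumes fin: "interval_finite R" and g: "g \<in> mor (grpd R)" and s: "s \<in> mor (grpd R)"
    and st: "tgt s = tgt g" and nz: "cocycle R s \<noteq> \<zero>\<^bsub>bring R (tgt g)\<^esub>"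
    and le: "brng_le (bring R (tgt g)) (cocycle R s) (cocycle R g)"
  shows "card (weak_interval (cmp (invm s) g)) < card (weak_interval g)"
proof -
  let ?B = "bring R (tgt g)" and ?h = "cmp (invm s) g"
  interpret boolean_ring ?B by (rule ring_target[OF g])
  let ?f = "\<lambda>A. cocycle R s \<oplus>\<^bsub>?B\<^esub> act R s A"
  have h: "?h \<in> mor (grpd R)" "tgt ?h = src s"
    using G.comp_closed[of "invm s" g] G.target_comp[of "invm s" g] G.ginv[OF s] g st by auto
  have Ns: "cocycle R s \<in> carrier ?B" and Ng: "cocycle R g \<in> carrier ?B"
    using cocycle_closed s g st by force+
  have Nh: "cocycle R ?h \<in> carrier (bring R (src s))" using cocycle_closed[OF h(1)] h by simp
  have sc: "act R s A \<in> carrier ?B" if "A \<in> carrier (bring R (src s))" for A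
    using act_closed[OF s that] st by simp
  have WB: "A \<in> carrier (bring R (src s))" if "A \<in> weak_interval ?h" for A
    using that weak_order_subset_carrier h by (auto simp: weak_interval_def)
  have sg: "cocycle R s \<otimes>\<^bsub>?B\<^esub> cocycle R g = cocycle R s" using le by (simp add: brng_le_def)
  have sh: "act R s (cocycle R ?h) = cocycle R g \<oplus>\<^bsub>?B\<^esub> cocycle R s"
    using cocycle_comp_ginv[OF s g] st by simp
  \<comment> \<open>\<open>sA\<close> lies below \<open>sN(s* g) = N(g) + N(s)\<close>, which is
    contained in \<open>N(g)\<close> and disjoint from \<open>N(s)\<close>.\<close>
  have below: "act R s A \<otimes>\<^bsub>?B\<^esub> cocycle R g = act R s A \<and> act R s A \<otimes>\<^bsub>?B\<^esub> cocycle R s = \<zero>\<^bsub>?B\<^esub>"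
    if A: "A \<in> weak_interval ?h" for A
  proof -
    let ?x = "act R s A" and ?y = "act R s (cocycle R ?h)"
    have x: "?x \<in> carrier ?B" and y: "?y \<in> carrier ?B" using sc WB[OF A] Nh by auto
    have "A \<otimes>\<^bsub>bring R (src s)\<^esub> cocycle R ?h = A"
      using A h by (simp add: weak_interval_def brng_le_def)
    then have xy: "?x \<otimes>\<^bsub>?B\<^esub> ?y = ?x" using act_mult[OF s WB[OF A] Nh] st by simp
    have yg: "?y \<otimes>\<^bsub>?B\<^esub> cocycle R g = ?y"
      using l_distr[OF Ng Ns Ng] idem[OF Ng] sg sh by simp
    have ys: "?y \<otimes>\<^bsub>?B\<^esub> cocycle R s = \<zero>\<^bsub>?B\<^esub>"
      using l_distr[OF Ng Ns Ns] idem[OF Ns] sg mult_comm[OF Ng Ns] add_self[OF Ns] sh by simp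
    show ?thesis
      using m_assoc[OF x y Ng] m_assoc[OF x y Ns] xy yg ys mult_zero_right[OF x] by simp
  qed
  have inj: "inj_on ?f (weak_interval ?h)"
  proof (rule inj_onI)
    fix A A' assume A: "A \<in> weak_interval ?h" "A' \<in> weak_interval ?h" "?f A = ?f A'"
    then have "act R s A = act R s A'"
      using add_cancel_left[OF Ns sc[OF WB]] by metis
    then show "A = A'" using act_bij[OF s] WB A by (auto simp: bij_betw_def inj_on_def)
  qed
  have sub: "?f ` weak_interval ?h \<subseteq> weak_interval g - {\<zero>\<^bsub>?B\<^esub>}"
  proof (rule image_subsetI)
    fix A assume A: "A \<in> weak_interval ?h"
    then obtain k where k: "k \<in> mor (grpd R)" "tgt k = src s" "A = cocycle R k"
      using h by (auto simp: weak_interval_def weak_order_def morphisms_to_def)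
    have "?f A = cocycle R (cmp s k)" using cocycle_comp[OF s k(1)] k st by simp
    moreover have "cmp s k \<in> mor (grpd R)" "tgt (cmp s k) = tgt g"
      using G.comp_closed[OF s k(1)] G.target_comp[OF s k(1)] k st by auto
    ultimately have W: "?f A \<in> weak_order R (tgt g)"
      by (auto simp: weak_order_def morphisms_to_def)
    have x: "act R s A \<in> carrier ?B" using sc WB[OF A] .
    have "?f A \<otimes>\<^bsub>?B\<^esub> cocycle R g = ?f A" using l_distr[OF Ns x Ng] below[OF A] sg by simp
    \<comment> \<open>Every image still contains the nonzero \<open>N(s)\<close>.\<close>
    moreover have "?f A \<otimes>\<^bsub>?B\<^esub> cocycle R s = cocycle R s"
      using l_distr[OF Ns x Ns] below[OF A] idem[OF Ns] Ns by simp
    then have "?f A \<noteq> \<zero>\<^bsub>?B\<^esub>" using nz mult_zero_left[OF Ns] by auto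
    ultimately show "?f A \<in> weak_interval g - {\<zero>\<^bsub>?B\<^esub>}"
      using W by (simp add: weak_interval_def brng_le_def)
  qed
  have fg: "finite (weak_interval g)"
    using fin g G.target_closed[OF g]
    by (auto simp: interval_finite_def weak_interval_def morphisms_to_def)
  \<comment> \<open>Zero is the cocycle value at an identity, so it belongs to the interval below
    \<open>N(g)\<close>; omitting it gives the strict inequality.\<close>
  have "\<zero>\<^bsub>?B\<^esub> \<in> weak_order R (tgt g)"
    using cocycle_ident[OF G.target_closed[OF g]] G.ident_closed G.target_ident G.target_closed[OF g]
    by (force simp: weak_order_def morphisms_to_def)
  then have z: "\<zero>\<^bsub>?B\<^esub> \<in> weak_interval g"
    using mult_zero_left[OF Ng] by (simp add: weak_interval_def brng_le_def)
  have "card (weak_interval ?h) \<le> card (weak_interval g - {\<zero>\<^bsub>?B\<^esub>})"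
    using card_inj_on_le[OF inj sub] fg by simp
  also have "\<dots> < card (weak_interval g)" using fg z by (rule card_Diff1_less)
  finally show ?thesis .
qed

text \<open>Each atomic morphism split off costs one letter and one unit of rank. Finiteness of rank
  is carried through the same induction because the rank formula for adding an atom requires it. The
  hypothesis \<open>sub\<close> is what abridgement will supply.\<close>

lemma preprincipal_product:
  assumes pre: "preprincipal_protorootoid R"
    and sub: "atomic_morphisms R \<subseteq> simple_morphisms R" and g: "g \<in> mor (grpd R)"
  shows "finite_rank (bring R (tgt g)) (cocycle R g) \<and>
    (g \<in> ids \<or> (\<exists>gs. is_product (grpd R) (simple_morphisms R) g gs \<and>
      length gs = cocycle_length R g))"
  using g
proof (induction "card (weak_interval g)" arbitrary: g rule: less_induct)
  case less
  note g = less.prems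
  let ?B = "bring R (tgt g)" and ?S = "simple_morphisms R"
  have o: "tgt g \<in> ob (grpd R)" by (rule G.target_closed[OF g])
  interpret boolean_ring ?B by (rule ring_target[OF g])
  have faith: "faithful R" and fin: "interval_finite R"
    using pre by (auto simp: preprincipal_protorootoid_def)
  show ?case
  proof (cases "cocycle R g = \<zero>\<^bsub>?B\<^esub>")
    case True
    then have "g = ident (grpd R) (tgt g)"
      using faith g o by (auto simp: faithful_def morphisms_to_def)
    then show ?thesis using True finite_rank_zero o by auto
  next
    case False
    obtain s where sA: "s \<in> atomic_morphisms R" and st: "tgt s = tgt g"
      and le: "brng_le ?B (cocycle R s) (cocycle R g)"
      using atomic_below[OF fin g False] .
    have sS: "s \<in> ?S" using sA sub by blast
    then have s: "s \<in> mor (grpd R)" and satom: "is_atom ?B (carrier ?B) (cocycle R s)"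
      using st by (auto simp: simple_morphisms_def)
    let ?h = "cmp (invm s) g"
    have h: "?h \<in> mor (grpd R)" "tgt ?h = src s"
      using G.comp_closed[of "invm s" g] G.target_comp[of "invm s" g] G.ginv[OF s] g st by auto
    have geq: "g = cmp s ?h" using G.comp_ginv_comp[OF s g] st by simp
    have nz: "cocycle R s \<noteq> \<zero>\<^bsub>?B\<^esub>" using satom by (simp add: is_atom_def)
    have Ns: "cocycle R s \<in> carrier ?B" and Ng: "cocycle R g \<in> carrier ?B"
      using cocycle_closed s g st by force+
    have Nh: "cocycle R ?h \<in> carrier (bring R (src s))" using cocycle_closed[OF h(1)] h by simp
    let ?x = "act R s (cocycle R ?h)"
    have x: "?x \<in> carrier ?B" using act_closed[OF s Nh] st by simp
    have xeq: "?x = cocycle R g \<oplus>\<^bsub>?B\<^esub> cocycle R s" using cocycle_comp_ginv[OF s g] st by simp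
    have xs: "?x \<otimes>\<^bsub>?B\<^esub> cocycle R s = \<zero>\<^bsub>?B\<^esub>"
      using l_distr[OF Ng Ns Ns] idem[OF Ns] le mult_comm[OF Ng Ns] add_self[OF Ns] xeq
      by (simp add: brng_le_def)
    have gx: "cocycle R g = ?x \<oplus>\<^bsub>?B\<^esub> cocycle R s"
      using xeq a_assoc[OF Ng Ns Ns] add_self[OF Ns] Ng by simp
    have IH: "finite_rank (bring R (tgt ?h)) (cocycle R ?h) \<and>
        (?h \<in> ids \<or> (\<exists>gs. is_product (grpd R) ?S ?h gs \<and> length gs = cocycle_length R ?h))"
      by (rule less.hyps[OF card_weak_interval_less[OF fin g s st nz le] h(1)])
    have finx: "finite_rank ?B ?x"
      using IH finite_rank_act[OF s Nh] h(2) st by simp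
    have rk: "brng_rank ?B ?x = cocycle_length R ?h"
      using rank_act[OF s Nh] h(2) st by (simp add: cocycle_length_def)
    have fing: "finite_rank ?B (cocycle R g)"
      using finite_rank_add_atom[OF satom x finx] gx by simp
    have len: "cocycle_length R g = Suc (cocycle_length R ?h)"
      using brng_rank_add_atom[OF satom x finx xs] gx rk by (simp add: cocycle_length_def)
    have "\<exists>gs. is_product (grpd R) ?S g gs \<and> length gs = cocycle_length R g"
    \<comment> \<open>For an identity the induction hypothesis yields no list; then \<open>g\<close>
      is \<open>s\<close>, and its rank is one because that of \<open>?h\<close> is zero.\<close>
    proof (cases "?h \<in> ids")
      case True
      then have "?h = ident (grpd R) (src s)" using h(2) G.target_ident by auto
      then have "g = s" using geq G.comp_ident_right[OF s] by simp
      then show ?thesis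
        using sS len cocycle_length_ident[OF True]
        by (intro exI[of _ "[s]"]) (simp add: is_product_def)
    next
      case False
      then obtain gs where gs: "is_product (grpd R) ?S ?h gs" "length gs = cocycle_length R ?h"
        using IH by blast
      have "is_product (grpd R) ?S g (s # gs)"
        using G.is_product_Cons[OF simple_mor] gs sS h(2) geq by (metis is_product_def)
      then show ?thesis using gs(2) len by (intro exI[of _ "s # gs"]) simp
    qed
    then show ?thesis using fing by blast
  qed
qed

text \<open>A prefixed factor \<open>s\<close> turns \<open>N(h)\<close> into
  \<open>sN(h) + N(s)\<close>: the action keeps the rank and the atom raises it by at most one. This
  gives the lower bound on word length.\<close>

lemma cocycle_length_le_product:
  assumes cf: "cocycle_finite R" and "is_product (grpd R) (simple_morphisms R) g gs"
  shows "cocycle_length R g \<le> length gs"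
  using assms(2)
proof (induction gs arbitrary: g)
  case Nil
  then show ?case by (simp add: is_product_def)
next
  case (Cons s hs)
  have s: "s \<in> simple_morphisms R" using Cons.prems by (simp add: is_product_def)
  then have sm: "s \<in> mor (grpd R)" using simple_mor by blast
  interpret boolean_ring "bring R (tgt s)" by (rule ring_target[OF sm])
  have satom: "is_atom (bring R (tgt s)) (carrier (bring R (tgt s))) (cocycle R s)"
    using s by (simp add: simple_morphisms_def)
  have Ns: "cocycle R s \<in> carrier (bring R (tgt s))" by (rule cocycle_closed[OF sm])
  show ?case
  proof (cases "hs = []")
    case True
    then have "g = s" using Cons.prems by (simp add: is_product_def)
    then show ?thesis
      \<comment> \<open>A single letter is treated as an atom added to zero.\<close>
      using brng_rank_add_atom_le[OF satom zero_closed finite_rank_zero] brng_rank_zero Ns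
      by (simp add: cocycle_length_def)
  next
    case False
    then obtain h where h: "is_product (grpd R) (simple_morphisms R) h hs"
      "src s = tgt h" "g = cmp s h"
      using G.is_product_Cons[OF simple_mor] Cons.prems by metis
    have hm: "h \<in> mor (grpd R)" using G.is_product_mor[OF simple_mor h(1)] by simp
    have Nh: "cocycle R h \<in> carrier (bring R (src s))" using cocycle_closed[OF hm] h by simp
    let ?x = "act R s (cocycle R h)"
    have x: "?x \<in> carrier (bring R (tgt s))" by (rule act_closed[OF sm Nh])
    have "finite_rank (bring R (tgt s)) ?x"
      using finite_rank_act[OF sm Nh] cf hm h(2) by (simp add: cocycle_finite_def)
    then have "brng_rank (bring R (tgt s)) (?x \<oplus>\<^bsub>bring R (tgt s)\<^esub> cocycle R s)
        \<le> Suc (cocycle_length R h)"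
      using brng_rank_add_atom_le[OF satom x] rank_act[OF sm Nh] h(2)
      by (simp add: cocycle_length_def)
    moreover have "cocycle R g = ?x \<oplus>\<^bsub>bring R (tgt s)\<^esub> cocycle R s" "tgt g = tgt s"
      using cocycle_comp[OF sm hm h(2)] h(3) a_comm[OF x Ns] G.target_comp[OF sm hm h(2)] by auto
    ultimately show ?thesis using Cons.IH[OF h(1)] by (simp add: cocycle_length_def)
  qed
qed

text \<open>The products built by splitting bound the length above by the rank, and
  \<open>cocycle_length_le_product\<close> bounds it below.\<close>

lemma preprincipal_imp_principal:
  assumes pre: "preprincipal_protorootoid R"
    and sub: "atomic_morphisms R \<subseteq> simple_morphisms R"
  shows "principal_protorootoid R"
proof -
  let ?S = "simple_morphisms R"
  note product = preprincipal_product[OF pre sub]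
  have cf: "cocycle_finite R" using product by (simp add: cocycle_finite_def)
  have gen: "generates (grpd R) ?S"
    unfolding generates_def simple_Un_ginv using product simple_mor by blast
  have "gen_length (grpd R) ?S g = cocycle_length R g" if g: "g \<in> mor (grpd R)" for g
  proof (cases "g \<in> ids")
    case True
    then show ?thesis using cocycle_length_ident by (simp add: gen_length_def)
  next
    case False
    then obtain gs where gs: "is_product (grpd R) ?S g gs" "length gs = cocycle_length R g"
      using product[OF g] by blast
    have "gen_length (grpd R) ?S g \<le> cocycle_length R g"
      using G.gen_length_le[of ?S g gs] gs simple_Un_ginv by simp
    moreover have "cocycle_length R g \<le> gen_length (grpd R) ?S g"
      using G.gen_length_product[OF gen g False] cocycle_length_le_product[OF cf] simple_Un_ginv
      by metis
    ultimately show ?thesis by simp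
  qed
  then show ?thesis using cf gen by (simp add: principal_protorootoid_def)
qed

lemma atomic_subset_simple_abridgement:
  assumes pre: "preprincipal_protorootoid R"
  shows "atomic_morphisms R \<subseteq> simple_morphisms (abridgement R)"
proof
  fix s assume sA: "s \<in> atomic_morphisms R"
  let ?B = "bring R (tgt s)" and ?W = "weak_order R (tgt s)" and ?e = "cocycle R s"
  have s: "s \<in> mor (grpd R)" and atom: "is_atom ?B ?W ?e"
    using sA by (auto simp: atomic_morphisms_def)
  interpret boolean_ring ?B by (rule ring_target[OF s])
  have e: "?e \<in> carrier ?B" by (rule cocycle_closed[OF s])
  \<comment> \<open>The elements on which multiplication by \<open>N(s)\<close> behaves as for an
    atom of the ring; they form a subring even where \<open>N(s)\<close> is not an atom of
    \<open>?B\<close>.\<close>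
  let ?H = "{x \<in> carrier ?B. x \<otimes>\<^bsub>?B\<^esub> ?e = \<zero>\<^bsub>?B\<^esub> \<or> x \<otimes>\<^bsub>?B\<^esub> ?e = ?e}"
  have neg: "\<ominus>\<^bsub>?B\<^esub> x = x" if "x \<in> carrier ?B" for x
    using add_self[OF that] that minus_equality by blast
  have "subgroup ?H (add_monoid ?B)"
  proof (rule add.subgroupI)
    show "?H \<noteq> {}" using mult_zero_left[OF e] by blast
  next
    fix x assume "x \<in> ?H" then show "\<ominus>\<^bsub>?B\<^esub> x \<in> ?H" using neg by auto
  next
    fix x y assume "x \<in> ?H" "y \<in> ?H"
    then show "x \<oplus>\<^bsub>?B\<^esub> y \<in> ?H" using l_distr[of x y ?e] e add_self[OF e] by auto
  qed auto
  moreover have "x \<otimes>\<^bsub>?B\<^esub> y \<in> ?H" if "x \<in> ?H" "y \<in> ?H" for x y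
    using that m_assoc[of x y ?e] m_closed mult_zero_right e by auto
  ultimately have H: "nonunital_subring ?H ?B"
    by (simp add: nonunital_subring_def additive_subgroup_def)
  have "?W \<subseteq> ?H"
  proof
    fix x assume "x \<in> ?W"
    then obtain g where g: "g \<in> morphisms_to (grpd R) (tgt s)" "x = cocycle R g"
      by (auto simp: weak_order_def)
    then have x: "x \<in> carrier ?B" using \<open>x \<in> ?W\<close> weak_order_subset_carrier by blast
    have "s \<in> atomic_morphisms R \<inter> morphisms_to (grpd R) (tgt s)"
      using sA s by (simp add: morphisms_to_def)
    then have "x \<otimes>\<^bsub>?B\<^esub> ?e = \<zero>\<^bsub>?B\<^esub> \<or> brng_le ?B ?e x"
      using pre g G.target_closed[OF s] unfolding preprincipal_protorootoid_def by blast
    then show "x \<in> ?H" using x mult_comm[OF x e] by (auto simp: brng_le_def)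
  qed
  then have gen: "generated_subring ?B ?W \<subseteq> ?H" by (rule generated_subring_least[OF H])
  have "?e \<in> generated_subring ?B ?W"
    using atom generated_subring_incl[of ?W ?B] by (auto simp: is_atom_def)
  \<comment> \<open>An element \<open>y\<close> of the generated ring below \<open>?e\<close> equals
    \<open>y \<otimes> ?e\<close>, and membership in \<open>?H\<close> makes this zero or
    \<open>?e\<close>.\<close>
  then show "s \<in> simple_morphisms (abridgement R)"
    using s atom gen
    by (auto simp: simple_morphisms_def abridgement_def is_atom_def brng_le_def)
qed

end

section \<open>Abridgement\<close>

lemma weak_order_abridgement: "weak_order (abridgement R) = weak_order R"
  by (simp add: weak_order_def abridgement_def fun_eq_iff)

text \<open>Atoms of the weak order refer to the ring only through zero and multiplication, both
  inherited by the abridgement.\<close>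

lemma atomic_abridgement: "atomic_morphisms (abridgement R) = atomic_morphisms R"
  by (simp add: atomic_morphisms_def weak_order_abridgement)
    (simp add: abridgement_def is_atom_def brng_le_def)

lemma preprincipal_abridgement:
  "preprincipal_protorootoid (abridgement R) \<longleftrightarrow> preprincipal_protorootoid R"
  unfolding preprincipal_protorootoid_def faithful_def interval_finite_def atomic_abridgement
    weak_order_abridgement
  by (simp add: abridgement_def brng_le_def)

theorem proposition3p11:
  fixes R :: "('o, 'm, 'b) protorootoid"
  assumes "protorootoid R"
  shows "(preprincipal_protorootoid R \<longleftrightarrow> principal_protorootoid (abridgement R)) \<and>
         (preprincipal_protorootoid R \<longrightarrow> atomic_morphisms R = simple_morphisms (abridgement R))"
proof -
  interpret R: protorootoid R by fact
  interpret A: protorootoid "abridgement R" by (rule R.protorootoid_abridgement)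
  show ?thesis
    \<comment> \<open>The implications between the two notions are applied to the abridgement; only
      the inclusion of atomic in simple morphisms starts from \<open>R\<close>, and the converse
      inclusion holds in any protorootoid.\<close>
    using R.atomic_subset_simple_abridgement A.simple_subset_atomic
      A.principal_imp_preprincipal A.preprincipal_imp_principal
    unfolding atomic_abridgement preprincipal_abridgement by blast
qed

end
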